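(* Let $a>0$ and $b,d,b',d'\in\mathbb{C}$ with $\operatorname{Re}(b),\operatorname{Re}(d),\operatorname{Re}(b'),\operatorname{Re}(d')>0$, $b+d=b'+d'$, $\bar d=b$ and $\bar d'=b'$. Then for $|r|<1$ and $x,y\in\mathbb{R}$, $$\sum_{j=0}^\infty h_j\,p_j(x;a,b,a,d)\,p_j(y;a,b',a,d')\,r^j={}_2F_1\!\left({a+ix,\ a+iy\atop 2a};r\right){}_2F_1\!\left({d-ix,\ d'-iy\atop b+d};r\right),$$ where $$h_j=\frac{(-1)^j j!}{(2a)_j(b+d)_j(2a+b+d+j-1)_j}\,{}_2F_1\!\left({a+d+j,\ a+d'+j\atop 2a+b+d+2j};r\right).$$
   Context: Continuous Hahn polynomials: $p_n(x;a,b,c,d)=i^n\frac{(a+c)_n(a+d)_n}{n!}\,{}_3F_2\!\left({-n,\ n+a+b+c+d-1,\ a+ix\atop a+c,\ a+d};1\right)$, with $(\alpha)_n$ the Pochhammer symbol. *)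

theory Defs
  imports "HOL-Analysis.Analysis"
begin

definition hypergeom :: "complex list \<Rightarrow> complex list \<Rightarrow> complex \<Rightarrow> complex" where
  "hypergeom as bs z =
     (\<Sum>n. (\<Prod>a\<leftarrow>as. pochhammer a n) / (\<Prod>b\<leftarrow>bs. pochhammer b n) * z ^ n / fact n)"

definition cont_hahn :: "nat \<Rightarrow> real \<Rightarrow> complex \<Rightarrow> complex \<Rightarrow> complex \<Rightarrow> complex \<Rightarrow> complex" where
  "cont_hahn n x a b c d =
     \<i> ^ n * pochhammer (a + c) n * pochhammer (a + d) n / fact n *
     hypergeom [- of_nat n, of_nat n + a + b + c + d - 1, a + \<i> * of_real x] [a + c, a + d] 1"

end

(*
  Write \<alpha> = 2a, \<beta> = b + d, s = a + d, t = a + d', A = a + ix and B = a + iy, so that d - ix = s - A and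
  d' - iy = t - B. By Chu--Vandermonde, (s)_N times the 3F2 in p_j(x) is a combination of the products
  (A)_m (s - A)_(N-m), m \<le> N, whose coefficients are the values at m of the j-th Hahn polynomial with
  parameters (\<alpha> - 1, \<beta> - 1, N); these do not depend on s. Dual orthogonality of the Hahn polynomials then
  diagonalises the coefficient of r^N on the left-hand side, which becomes the coefficient of r^N in the
  product of the two 2F1 series.

  For convergence, take t and B to be the complex conjugates of s and A: then all terms of that coefficient
  identity are nonnegative, so the double series on the left is absolutely summable. The mixed terms are
  dominated by AM-GM, which justifies the rearrangement for arbitrary x and y.
*)
theory Submission
  imports Defs "HOL-Computational_Algebra.Polynomial" "Jordan_Normal_Form.Determinant"
begin

subsection \<open>Alternating binomial sums and Pochhammer symbols\<close>

text \<open>The shift by \<open>k\<close> is built in because most later denominators have as base a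
  number outside the nonpositive integers plus a natural number.\<close>

lemma pochhammer_nonzero:
  fixes z :: "'a :: field_char_0"
  assumes "z \<notin> \<int>\<^sub>\<le>\<^sub>0"
  shows "pochhammer (z + of_nat k) n \<noteq> 0"
proof
  assume "pochhammer (z + of_nat k) n = 0"
  then obtain i where "z + of_nat k = - of_nat i"
    by (auto simp: pochhammer_eq_0_iff)
  then have "z + of_nat (k + i) = 0"
    by (simp add: eq_neg_iff_add_eq_0 add_ac)
  then show False
    using assms plus_of_nat_eq_0_imp by blast
qed

text \<open>Up to sign this is an \<open>n\<close>-th finite difference at 0, and each difference
  lowers the degree. The induction writes p = a + X q and absorbs the factor k into the binomial
  coefficient, which leaves the polynomial q(X + 1), of degree one less.\<close>

lemma sum_alternating_choose_poly:
  fixes p :: "'a :: idom poly"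
  assumes "degree p < n"
  shows "(\<Sum>k\<le>n. (-1) ^ k * of_nat (n choose k) * poly p (of_nat k)) = 0"
  using assms
proof (induction n arbitrary: p)
  case 0
  then show ?case by simp
next
  case (Suc n)
  obtain a q where p: "p = pCons a q"
    by (cases p)
  let ?r = "pcompose q [:1, 1:]"
  have absorb: "of_nat (Suc n choose Suc k) * (1 + of_nat k) =
      (of_nat (Suc n) :: 'a) * of_nat (n choose k)" for k
    by (metis Suc_times_binomial mult.commute of_nat_Suc of_nat_mult)
  have "(\<Sum>k\<le>Suc n. (-1) ^ k * of_nat (Suc n choose k) * (of_nat k * poly q (of_nat k))) =
      (\<Sum>k\<le>n. (-1) ^ Suc k * of_nat (Suc n choose Suc k) *
        ((1 + of_nat k) * poly q (1 + of_nat k)))"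
    by (subst sum.atMost_Suc_shift) simp
  also have "\<dots> = (\<Sum>k\<le>n. - of_nat (Suc n) * ((-1) ^ k * of_nat (n choose k) * poly ?r (of_nat k)))"
  proof (rule sum.cong[OF refl])
    fix k
    have "(-1) ^ Suc k * of_nat (Suc n choose Suc k) * ((1 + of_nat k) * poly q (1 + of_nat k)) =
        (-1) ^ Suc k * (of_nat (Suc n choose Suc k) * (1 + of_nat k)) * poly q (1 + of_nat k)"
      by (simp only: mult_ac)
    also have "\<dots> = - of_nat (Suc n) * ((-1) ^ k * of_nat (n choose k) * poly ?r (of_nat k))"
      unfolding absorb by (simp add: poly_pcompose algebra_simps)
    finally show "(-1) ^ Suc k * of_nat (Suc n choose Suc k) *
        ((1 + of_nat k) * poly q (1 + of_nat k)) =
        - of_nat (Suc n) * ((-1) ^ k * of_nat (n choose k) * poly ?r (of_nat k))" .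
  qed
  also have "\<dots> = - of_nat (Suc n) * (\<Sum>k\<le>n. (-1) ^ k * of_nat (n choose k) * poly ?r (of_nat k))"
    by (simp only: sum_distrib_left)
  also have "\<dots> = 0"
  \<comment> \<open>For nonzero q the degree of p is that of q plus one, which gives the bound
    needed for the induction hypothesis. For q = 0 the bound on p says nothing when \<open>n\<close>
    is 0.\<close>
  proof (cases "q = 0")
    case False
    then have "degree ?r < n"
      using Suc.prems p by (simp add: degree_pcompose)
    then show ?thesis
      using Suc.IH[of ?r] by simp
  qed simp
  finally have "(\<Sum>k\<le>Suc n. (-1) ^ k * of_nat (Suc n choose k) * (of_nat k * poly q (of_nat k))) = 0" .
  moreover have "(\<Sum>k\<le>Suc n. (-1) ^ k * of_nat (Suc n choose k) * a) = 0"
    using choose_alternating_sum[of "Suc n", where ?'a = 'a]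
    by (simp only: flip: sum_distrib_right) simp
  ultimately show ?case
    unfolding p by (simp only: poly_pCons distrib_left sum.distrib) simp
qed

text \<open>The partial fraction expansion of n! / (z)_(n+1). By Pascal's rule the sum for n + 1 at
  z is the sum for n at z minus the sum for n at z + 1, so the induction has to vary z.\<close>

lemma sum_alternating_choose_inverse:
  fixes z :: "'a :: field_char_0"
  assumes "z \<notin> \<int>\<^sub>\<le>\<^sub>0"
  shows "(\<Sum>k\<le>n. (-1) ^ k * of_nat (n choose k) / (z + of_nat k)) = fact n / pochhammer z (Suc n)"
  using assms
proof (induction n arbitrary: z)
  case 0
  then show ?case by simp
next
  case (Suc n)
  have z1: "z + 1 \<notin> \<int>\<^sub>\<le>\<^sub>0"
  proof
    assume "z + 1 \<in> \<int>\<^sub>\<le>\<^sub>0"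
    then obtain i where "z + 1 = - of_nat i"
      by (rule nonpos_Ints_cases')
    then have "z + of_nat (Suc i) = 0"
      by (simp add: eq_neg_iff_add_eq_0 add_ac)
    with Suc.prems show False
      using plus_of_nat_eq_0_imp by blast
  qed
  have nz: "z + of_nat k \<noteq> 0" for k
    using Suc.prems plus_of_nat_eq_0_imp by blast
  define f where "f k = (-1) ^ k / (z + of_nat k)" for k
  have "(\<Sum>k\<le>Suc n. of_nat (Suc n choose k) * f k) =
      f 0 + (\<Sum>k\<le>n. of_nat (Suc n choose Suc k) * f (Suc k))"
    by (subst sum.atMost_Suc_shift) simp
  also have "\<dots> = (f 0 + (\<Sum>k\<le>n. of_nat (n choose Suc k) * f (Suc k))) +
      (\<Sum>k\<le>n. of_nat (n choose k) * f (Suc k))"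
    by (simp add: sum.distrib algebra_simps)
  also have "f 0 + (\<Sum>k\<le>n. of_nat (n choose Suc k) * f (Suc k)) =
      (\<Sum>k\<le>Suc n. of_nat (n choose k) * f k)"
    by (subst sum.atMost_Suc_shift) simp
  also have "\<dots> = (\<Sum>k\<le>n. of_nat (n choose k) * f k)"
    by simp
  also have "\<dots> = fact n / pochhammer z (Suc n)"
    using Suc.IH[OF Suc.prems] by (simp add: f_def mult_ac)
  also have "(\<Sum>k\<le>n. of_nat (n choose k) * f (Suc k)) = - fact n / pochhammer (z + 1) (Suc n)"
    using Suc.IH[OF z1] by (simp add: f_def mult_ac add_ac sum_negf)
  also have "fact n / pochhammer z (Suc n) + - fact n / pochhammer (z + 1) (Suc n) =
      fact (Suc n) / pochhammer z (Suc (Suc n))"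
  proof -
    have p: "pochhammer (z + 1) n \<noteq> 0"
      using pochhammer_nonzero[OF Suc.prems, of 1 n] by simp
    have "z \<noteq> 0" "z + 1 + of_nat n \<noteq> 0"
      using nz[of 0] nz[of "Suc n"] by (simp_all add: add_ac)
    moreover have "pochhammer z (Suc n) = z * pochhammer (z + 1) n"
      "pochhammer (z + 1) (Suc n) = pochhammer (z + 1) n * (z + 1 + of_nat n)"
      "pochhammer z (Suc (Suc n)) = z * (pochhammer (z + 1) n * (z + 1 + of_nat n))"
      by (simp_all only: pochhammer_rec[of z] pochhammer_Suc[of "z + 1"])
    ultimately show ?thesis
      using p by (simp add: divide_simps) (simp add: algebra_simps)
  qed
  finally show ?case
    by (simp add: f_def mult_ac)
qed

text \<open>Division with remainder gives p = p(-z) + (X + z) q. The quotient q has degree below n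
  and contributes nothing; the constant p(-z) is weighted by the partial fraction sum.\<close>

lemma sum_alternating_choose_poly_divide:
  fixes z :: "'a :: field_char_0"
  assumes "z \<notin> \<int>\<^sub>\<le>\<^sub>0" "degree p \<le> n"
  shows "(\<Sum>k\<le>n. (-1) ^ k * of_nat (n choose k) * poly p (of_nat k) / (z + of_nat k)) =
    poly p (- z) * fact n / pochhammer z (Suc n)"
proof -
  have nz: "z + of_nat k \<noteq> 0" for k
    using assms plus_of_nat_eq_0_imp by blast
  define c where "c = poly p (- z)"
  have "poly (p - [:c:]) (- z) = 0"
    by (simp add: c_def)
  then obtain q where q: "p - [:c:] = [:z, 1:] * q"
    by (metis dvdE minus_minus poly_eq_0_iff_dvd)
  have pv: "poly p x = c + (z + x) * poly q x" for x
    using arg_cong[OF q, of "\<lambda>p. poly p x"] by (simp add: algebra_simps)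
  have "(\<Sum>k\<le>n. (-1) ^ k * of_nat (n choose k) * poly p (of_nat k) / (z + of_nat k)) =
      (\<Sum>k\<le>n. c * ((-1) ^ k * of_nat (n choose k) / (z + of_nat k)) +
        (-1) ^ k * of_nat (n choose k) * poly q (of_nat k))"
    unfolding pv using nz by (intro sum.cong) (simp_all add: field_simps)
  also have "\<dots> = c * (fact n / pochhammer z (Suc n)) +
      (\<Sum>k\<le>n. (-1) ^ k * of_nat (n choose k) * poly q (of_nat k))"
    by (simp only: sum.distrib sum_alternating_choose_inverse[OF assms(1)] flip: sum_distrib_left)
  also have "(\<Sum>k\<le>n. (-1) ^ k * of_nat (n choose k) * poly q (of_nat k)) = 0"
  proof (cases "q = 0")
    case False
    have "degree ([:z, 1:] * q) = Suc (degree q)"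
      using False by (subst degree_mult_eq) auto
    moreover have "degree (p - [:c:]) \<le> n"
      using assms(2) by (intro degree_diff_le) auto
    ultimately have "degree q < n"
      using q by simp
    then show ?thesis
      by (rule sum_alternating_choose_poly)
  qed simp
  finally show ?thesis
    by (simp add: c_def)
qed

text \<open>Makes the alternating sums applicable to Pochhammer symbols whose base contains the
  summation index.\<close>

lemma pochhammer_as_poly:
  fixes c :: "'a :: comm_ring_1"
  obtains p where "degree p \<le> n" "\<And>x. poly p x = pochhammer (c + x) n"
proof
  let ?p = "\<Prod>i<n. [:c + of_nat i, 1:]"
  have "degree ?p \<le> (\<Sum>i<n. degree [:c + of_nat i, 1:])"
    using degree_prod_sum_le[of "{..<n}" "\<lambda>i. [:c + of_nat i, 1:]"] by (simp add: o_def)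
  then show "degree ?p \<le> n"
    by simp
  show "poly ?p x = pochhammer (c + x) n" for x
    by (simp add: poly_prod pochhammer_prod atLeast0LessThan add_ac)
qed

text \<open>
  Both sides are the Chu--Vandermonde convolution, shifted by \<^term>\<open>k\<close>:
  \<^term>\<open>pochhammer (- of_nat m) k\<close> turns \<^term>\<open>1 / fact m\<close> into \<^term>\<open>1 / fact (m - k)\<close>, up to sign.
\<close>
lemma pochhammer_vandermonde_shifted:
  fixes x y :: "'a :: field_char_0"
  assumes "k \<le> N"
  shows "(\<Sum>m\<le>N. pochhammer x m * pochhammer y (N - m) * pochhammer (- of_nat m) k /
      (fact m * fact (N - m))) =
    (-1) ^ k * pochhammer x k * pochhammer (x + y + of_nat k) (N - k) / fact (N - k)"
proof -
  let ?f = "\<lambda>m. pochhammer x m * pochhammer y (N - m) * pochhammer (- of_nat m) k /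
      (fact m * fact (N - m))"
  \<comment> \<open>The terms with m < k vanish because (-m)_k then contains the factor 0.\<close>
  have "(\<Sum>m\<le>N. ?f m) = (\<Sum>m\<in>{k..N}. ?f m)"
    using assms by (intro sum.mono_neutral_right) (auto simp: pochhammer_of_nat_eq_0_lemma)
  also have "\<dots> = (\<Sum>i\<le>N - k. ?f (i + k))"
    using assms sum.shift_bounds_cl_nat_ivl[of ?f 0 k "N - k"] by (simp add: atLeast0AtMost)
  also have "\<dots> = (\<Sum>i\<le>N - k. (-1) ^ k * pochhammer x k / fact (N - k) *
      (of_nat (N - k choose i) * pochhammer (x + of_nat k) i * pochhammer y (N - k - i)))"
  proof (rule sum.cong[OF refl])
    fix i assume "i \<in> {..N - k}"
    then have i: "i \<le> N - k"
      by simp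
    \<comment> \<open>Reflection reverses the order of the factors: (-1)^k (-(i + k))_k = (i + 1)_k
      = (i + k)! / i!.\<close>
    have "(-1 :: 'a) ^ k * pochhammer (- of_nat (i + k)) k = pochhammer (of_nat (i + k) - of_nat k + 1) k"
      unfolding pochhammer_minus by (simp flip: power_mult_distrib mult.assoc)
    also have "\<dots> = pochhammer (1 + of_nat i) k"
      by (simp add: add_ac)
    also have "\<dots> = fact (i + k) / fact i"
      using pochhammer_product'[of "1 :: 'a" i k] by (simp add: pochhammer_fact[symmetric])
    finally have "(-1) ^ k * ((-1) ^ k * pochhammer (- of_nat (i + k)) k) =
        (-1) ^ k * (fact (i + k) / fact i :: 'a)"
      by simp
    then have "pochhammer (- of_nat (i + k)) k = (-1) ^ k * (fact (i + k) / fact i :: 'a)"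
      by (simp flip: power_mult_distrib mult.assoc)
    moreover have "pochhammer x (i + k) = pochhammer x k * pochhammer (x + of_nat k) i"
      by (subst add.commute) (rule pochhammer_product')
    moreover have "of_nat (N - k choose i) = (fact (N - k) / (fact i * fact (N - k - i)) :: 'a)"
      using i by (rule binomial_fact)
    moreover have "N - (i + k) = N - k - i"
      by simp
    ultimately show "?f (i + k) = (-1) ^ k * pochhammer x k / fact (N - k) *
      (of_nat (N - k choose i) * pochhammer (x + of_nat k) i * pochhammer y (N - k - i))"
      by simp
  qed
  also have "\<dots> = (-1) ^ k * pochhammer x k / fact (N - k) * pochhammer (x + of_nat k + y) (N - k)"
    by (simp only: pochhammer_binomial_sum sum_distrib_left)
  finally show ?thesis
    by (simp add: add_ac)
qed

subsection \<open>Hahn polynomials and their dual orthogonality\<close>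

text \<open>
  The Hahn polynomial \<open>Q\<^sub>j(m; \<alpha> - 1, \<beta> - 1, N)\<close> multiplied by \<open>N!\<close>, where \<open>w = \<alpha> + \<beta> - 1\<close>.
  The factor \<open>(-1)\<^sup>k (j choose k)\<close> replaces \<open>(-j)\<^sub>k / k!\<close>, and
  \<open>(-1)\<^sup>k fact (N - k)\<close> replaces \<open>N! / (-N)\<^sub>k\<close>, which would be undefined for \<open>k > N\<close>.
\<close>
definition hahn :: "'a :: field_char_0 \<Rightarrow> 'a \<Rightarrow> nat \<Rightarrow> nat \<Rightarrow> nat \<Rightarrow> 'a" where
  "hahn \<alpha> w N j m = (\<Sum>k\<le>j. of_nat (j choose k) * pochhammer (of_nat j + w) k / pochhammer \<alpha> k *
     fact (N - k) * pochhammer (- of_nat m) k)"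

text \<open>The classical Hahn weight for the parameters (\<alpha> - 1, \<beta> - 1, N), a product
  of the generalised binomial coefficients (\<alpha>)_m / m! and (\<beta>)_(N-m) / (N-m)!.\<close>

definition hahn_weight :: "'a :: field_char_0 \<Rightarrow> 'a \<Rightarrow> nat \<Rightarrow> nat \<Rightarrow> 'a" where
  "hahn_weight \<alpha> \<beta> N m =
     pochhammer \<alpha> m * pochhammer \<beta> (N - m) / (fact m * fact (N - m))"

text \<open>At k = N - j this is the reciprocal of the squared norm of \<open>hahn\<close> (see
  \<open>hahn_norm\<close>). The argument is k rather than N because, as a function of k, it is also
  what remains of the coefficient of r^(j+k) in the j-th term of the generating function, once
  (s)_(j+k), (t)_(j+k) and the two 3F2 values are split off.\<close>

definition hahn_coeff :: "'a :: field_char_0 \<Rightarrow> 'a \<Rightarrow> nat \<Rightarrow> nat \<Rightarrow> 'a" where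
  "hahn_coeff \<alpha> \<beta> j k = pochhammer \<alpha> j / (fact j * pochhammer \<beta> j *
     pochhammer (\<alpha> + \<beta> - 1 + of_nat j) j * (pochhammer (\<alpha> + \<beta> + 2 * of_nat j) k * fact k))"

text \<open>The test functions (\<alpha> + m)_l are chosen because (\<alpha>)_m (\<alpha> + m)_l =
  (\<alpha>)_l (\<alpha> + l)_m: they are absorbed by the weight, which only shifts \<alpha> to
  \<alpha> + l. The sum over m is then a Vandermonde sum for each k.\<close>

lemma hahn_weight_pochhammer_sum:
  fixes \<alpha> \<beta> :: "'a :: field_char_0"
  assumes \<alpha>: "\<alpha> \<notin> \<int>\<^sub>\<le>\<^sub>0" and "j \<le> N"
  shows "(\<Sum>m\<le>N. hahn_weight \<alpha> \<beta> N m * hahn \<alpha> w N j m * pochhammer (\<alpha> + of_nat m) l) =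
    (\<Sum>k\<le>j. (-1) ^ k * of_nat (j choose k) * pochhammer (\<alpha> + of_nat k) l *
      (pochhammer (of_nat j + w) k * pochhammer (\<alpha> + \<beta> + of_nat l + of_nat k) (N - k)))"
proof -
  have "(\<Sum>m\<le>N. hahn_weight \<alpha> \<beta> N m * hahn \<alpha> w N j m * pochhammer (\<alpha> + of_nat m) l) =
    (\<Sum>m\<le>N. \<Sum>k\<le>j. of_nat (j choose k) * pochhammer (of_nat j + w) k / pochhammer \<alpha> k *
      fact (N - k) * pochhammer \<alpha> l * (pochhammer (\<alpha> + of_nat l) m * pochhammer \<beta> (N - m) *
        pochhammer (- of_nat m) k / (fact m * fact (N - m))))"
  proof (rule sum.cong[OF refl])
    fix m
    have "pochhammer \<alpha> m * pochhammer (\<alpha> + of_nat m) l = pochhammer \<alpha> l * pochhammer (\<alpha> + of_nat l) m"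
      by (metis add.commute pochhammer_product')
    then have "hahn_weight \<alpha> \<beta> N m * pochhammer (\<alpha> + of_nat m) l =
        pochhammer \<alpha> l * (pochhammer (\<alpha> + of_nat l) m * pochhammer \<beta> (N - m) / (fact m * fact (N - m)))"
      by (simp add: hahn_weight_def field_simps)
    moreover have "hahn_weight \<alpha> \<beta> N m * hahn \<alpha> w N j m * pochhammer (\<alpha> + of_nat m) l =
        hahn_weight \<alpha> \<beta> N m * pochhammer (\<alpha> + of_nat m) l * hahn \<alpha> w N j m"
      by simp
    ultimately show "hahn_weight \<alpha> \<beta> N m * hahn \<alpha> w N j m * pochhammer (\<alpha> + of_nat m) l =
      (\<Sum>k\<le>j. of_nat (j choose k) * pochhammer (of_nat j + w) k / pochhammer \<alpha> k *
      fact (N - k) * pochhammer \<alpha> l * (pochhammer (\<alpha> + of_nat l) m * pochhammer \<beta> (N - m) *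
        pochhammer (- of_nat m) k / (fact m * fact (N - m))))"
      by (simp add: hahn_def sum_distrib_left mult_ac)
  qed
  also have "\<dots> = (\<Sum>k\<le>j. of_nat (j choose k) * pochhammer (of_nat j + w) k / pochhammer \<alpha> k *
      fact (N - k) * pochhammer \<alpha> l * (\<Sum>m\<le>N. pochhammer (\<alpha> + of_nat l) m * pochhammer \<beta> (N - m) *
        pochhammer (- of_nat m) k / (fact m * fact (N - m))))"
    by (subst sum.swap) (simp only: sum_distrib_left)
  also have "\<dots> = (\<Sum>k\<le>j. (-1) ^ k * of_nat (j choose k) * pochhammer (\<alpha> + of_nat k) l *
      (pochhammer (of_nat j + w) k * pochhammer (\<alpha> + \<beta> + of_nat l + of_nat k) (N - k)))"
  proof (rule sum.cong[OF refl])
    fix k assume "k \<in> {..j}"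
    then have k: "k \<le> N"
      using assms by simp
    \<comment> \<open>Here F stands for \<open>fact (N - k)\<close>: the factor in
      \<open>hahn\<close> cancels the denominator left by the Vandermonde sum.\<close>
    have arrange: "c * p / q * F * r * (e * t * V / F) = e * c * (r * t / q) * (p * V)"
      if "F \<noteq> 0" for c p q F r e t V :: 'a
      using that by simp
    have nz: "pochhammer \<alpha> k \<noteq> 0"
      using pochhammer_nonzero[OF \<alpha>, of 0 k] by simp
    have "pochhammer \<alpha> l * pochhammer (\<alpha> + of_nat l) k = pochhammer \<alpha> k * pochhammer (\<alpha> + of_nat k) l"
      by (metis add.commute pochhammer_product')
    then have "pochhammer \<alpha> l * pochhammer (\<alpha> + of_nat l) k / pochhammer \<alpha> k = pochhammer (\<alpha> + of_nat k) l"
      using nz by simp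
    moreover have "pochhammer (\<alpha> + of_nat l + \<beta> + of_nat k) (N - k) =
        pochhammer (\<alpha> + \<beta> + of_nat l + of_nat k) (N - k)"
      by (simp add: add_ac)
    ultimately show "of_nat (j choose k) * pochhammer (of_nat j + w) k / pochhammer \<alpha> k *
      fact (N - k) * pochhammer \<alpha> l * (\<Sum>m\<le>N. pochhammer (\<alpha> + of_nat l) m * pochhammer \<beta> (N - m) *
        pochhammer (- of_nat m) k / (fact m * fact (N - m))) =
      (-1) ^ k * of_nat (j choose k) * pochhammer (\<alpha> + of_nat k) l *
      (pochhammer (of_nat j + w) k * pochhammer (\<alpha> + \<beta> + of_nat l + of_nat k) (N - k))"
      unfolding pochhammer_vandermonde_shifted[OF k] by (subst arrange) simp_all
  qed
  finally show ?thesis .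
qed

text \<open>
  After division by a factor independent of \<^term>\<open>k\<close>, the summand is an alternating binomial coefficient
  times a polynomial in \<^term>\<open>k\<close> of degree at most \<^term>\<open>j - 1\<close>.
\<close>
lemma hahn_orthogonal_pochhammer:
  fixes \<alpha> \<beta> :: "'a :: field_char_0"
  assumes \<alpha>: "\<alpha> \<notin> \<int>\<^sub>\<le>\<^sub>0" and \<alpha>\<beta>: "\<alpha> + \<beta> \<notin> \<int>\<^sub>\<le>\<^sub>0" and "j \<le> N" "l < j"
  shows "(\<Sum>m\<le>N. hahn_weight \<alpha> \<beta> N m * hahn \<alpha> (\<alpha> + \<beta> - 1) N j m * pochhammer (\<alpha> + of_nat m) l) = 0"
proof -
  define v where "v = \<alpha> + \<beta> + of_nat l"
  have nz: "pochhammer v k \<noteq> 0" for k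
    using pochhammer_nonzero[OF \<alpha>\<beta>] by (simp add: v_def)
  obtain p where p: "degree p \<le> l" "\<And>x. poly p x = pochhammer (\<alpha> + x) l"
    using pochhammer_as_poly[where c = \<alpha> and n = l] by blast
  obtain q where q: "degree q \<le> j - 1 - l" "\<And>x. poly q x = pochhammer (v + x) (j - 1 - l)"
    using pochhammer_as_poly[where c = v and n = "j - 1 - l"] by blast
  have pq: "degree (p * q) < j"
    using degree_mult_le[of p q] p(1) q(1) assms by linarith
  have "(\<Sum>k\<le>j. (-1) ^ k * of_nat (j choose k) * pochhammer (\<alpha> + of_nat k) l *
      (pochhammer (of_nat j + (\<alpha> + \<beta> - 1)) k * pochhammer (\<alpha> + \<beta> + of_nat l + of_nat k) (N - k))) =
    (\<Sum>k\<le>j. pochhammer v N / pochhammer v (j - 1 - l) *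
      ((-1) ^ k * of_nat (j choose k) * poly (p * q) (of_nat k)))"
  proof (rule sum.cong[OF refl])
    fix k assume "k \<in> {..j}"
    then have k: "k \<le> N"
      using assms by simp
    \<comment> \<open>The choice w = \<alpha> + \<beta> - 1 enters here: j + w exceeds v by exactly
      j - 1 - l, so the two symbols depending on k combine into a constant times the polynomial (v +
      k)_(j-1-l).\<close>
    have shift: "of_nat j + (\<alpha> + \<beta> - 1) = v + of_nat (j - 1 - l)"
      using assms by (simp add: v_def of_nat_diff)
    have "pochhammer v (j - 1 - l) * pochhammer (v + of_nat (j - 1 - l)) k =
        pochhammer v k * pochhammer (v + of_nat k) (j - 1 - l)"
      by (metis add.commute pochhammer_product')
    moreover have "pochhammer v N = pochhammer v k * pochhammer (v + of_nat k) (N - k)"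
      using k by (rule pochhammer_product)
    ultimately have "pochhammer (v + of_nat (j - 1 - l)) k * pochhammer (v + of_nat k) (N - k) =
        pochhammer v N / pochhammer v (j - 1 - l) * pochhammer (v + of_nat k) (j - 1 - l)"
      using nz[of k] nz[of "j - 1 - l"] by (simp add: field_simps)
    then show "(-1) ^ k * of_nat (j choose k) * pochhammer (\<alpha> + of_nat k) l *
      (pochhammer (of_nat j + (\<alpha> + \<beta> - 1)) k * pochhammer (\<alpha> + \<beta> + of_nat l + of_nat k) (N - k)) =
      pochhammer v N / pochhammer v (j - 1 - l) *
      ((-1) ^ k * of_nat (j choose k) * poly (p * q) (of_nat k))"
      unfolding shift poly_mult p(2) q(2) v_def[symmetric] by (simp add: mult_ac)
  qed
  also have "\<dots> = 0"
    unfolding sum_distrib_left[symmetric] sum_alternating_choose_poly[OF pq] by simp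
  finally show ?thesis
    using assms by (simp add: hahn_weight_pochhammer_sum)
qed

text \<open>In the critical case l = j the same cancellation leaves one factor z + k in the
  denominator, with z = \<alpha> + \<beta> + j - 1. The alternating sum is therefore evaluated by
  the value of (\<alpha> + x)_j at the pole x = -z.\<close>

lemma hahn_pochhammer_degree:
  fixes \<alpha> \<beta> :: "'a :: field_char_0"
  assumes \<alpha>: "\<alpha> \<notin> \<int>\<^sub>\<le>\<^sub>0" and \<alpha>\<beta>: "\<alpha> + \<beta> \<notin> \<int>\<^sub>\<le>\<^sub>0" and "j \<le> N"
  shows "(\<Sum>m\<le>N. hahn_weight \<alpha> \<beta> N m * hahn \<alpha> (\<alpha> + \<beta> - 1) N j m * pochhammer (\<alpha> + of_nat m) j) =
    (-1) ^ j * pochhammer (\<alpha> + \<beta> + 2 * of_nat j) (N - j) * pochhammer \<beta> j * fact j"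
proof (cases "j = 0")
  case True
  then show ?thesis
    using hahn_weight_pochhammer_sum[OF \<alpha>, of 0 N \<beta> "\<alpha> + \<beta> - 1" 0] by simp
next
  case False
  \<comment> \<open>For j > 0 this is \<alpha> + \<beta> plus a natural number and so avoids the
    nonpositive integers. For j = 0 it would have to be \<alpha> + \<beta> - 1, which might not;
    hence the case split.\<close>
  define z where "z = \<alpha> + \<beta> + of_nat (j - 1)"
  have z: "z \<notin> \<int>\<^sub>\<le>\<^sub>0"
  proof
    assume "z \<in> \<int>\<^sub>\<le>\<^sub>0"
    then obtain i where "z = - of_nat i"
      by (rule nonpos_Ints_cases')
    then have "\<alpha> + \<beta> + of_nat (j - 1 + i) = 0"
      by (simp add: z_def eq_neg_iff_add_eq_0 add_ac)
    with \<alpha>\<beta> show False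
      using plus_of_nat_eq_0_imp by blast
  qed
  have z0: "z \<noteq> 0" "z + of_nat k \<noteq> 0" for k
    using z plus_of_nat_eq_0_imp by auto
  have zj: "of_nat j + (\<alpha> + \<beta> - 1) = z" "\<alpha> + \<beta> + of_nat j = z + 1"
    using False by (simp_all add: z_def of_nat_diff)
  have nz: "pochhammer (z + 1) k \<noteq> 0" for k
    using pochhammer_nonzero[OF z, of 1 k] by simp
  obtain p where p: "degree p \<le> j" "\<And>x. poly p x = pochhammer (\<alpha> + x) j"
    using pochhammer_as_poly[where c = \<alpha> and n = j] by blast
  have "(\<Sum>k\<le>j. (-1) ^ k * of_nat (j choose k) * pochhammer (\<alpha> + of_nat k) j *
      (pochhammer (of_nat j + (\<alpha> + \<beta> - 1)) k * pochhammer (\<alpha> + \<beta> + of_nat j + of_nat k) (N - k))) =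
    (\<Sum>k\<le>j. pochhammer (z + 1) N * z *
      ((-1) ^ k * of_nat (j choose k) * poly p (of_nat k) / (z + of_nat k)))"
  proof (rule sum.cong[OF refl])
    fix k assume "k \<in> {..j}"
    then have k: "k \<le> N"
      using assms by simp
    have shift: "pochhammer z k * (z + of_nat k) = z * pochhammer (z + 1) k"
      by (metis pochhammer_Suc pochhammer_rec)
    have split: "pochhammer (z + 1) N = pochhammer (z + 1) k * pochhammer (z + 1 + of_nat k) (N - k)"
      using k by (rule pochhammer_product)
    have "pochhammer z k * pochhammer (z + 1 + of_nat k) (N - k) * (z + of_nat k) =
        pochhammer z k * (z + of_nat k) * pochhammer (z + 1 + of_nat k) (N - k)"
      by (simp only: mult_ac)
    also have "\<dots> = pochhammer (z + 1) N * z"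
      unfolding shift split by (simp only: mult_ac)
    finally have "pochhammer z k * pochhammer (z + 1 + of_nat k) (N - k) =
        pochhammer (z + 1) N * z / (z + of_nat k)"
      by (subst nonzero_eq_divide_eq[OF z0(2)])
    then show "(-1) ^ k * of_nat (j choose k) * pochhammer (\<alpha> + of_nat k) j *
      (pochhammer (of_nat j + (\<alpha> + \<beta> - 1)) k * pochhammer (\<alpha> + \<beta> + of_nat j + of_nat k) (N - k)) =
      pochhammer (z + 1) N * z *
      ((-1) ^ k * of_nat (j choose k) * poly p (of_nat k) / (z + of_nat k))"
      unfolding zj p(2) by (simp add: mult_ac)
  qed
  also have "\<dots> = pochhammer (z + 1) N * z * (poly p (- z) * fact j / pochhammer z (Suc j))"
    unfolding sum_distrib_left[symmetric] sum_alternating_choose_poly_divide[OF z p(1)] ..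
  \<comment> \<open>Reflection again: \<alpha> - z = -(\<beta> + j - 1).\<close>
  also have "poly p (- z) = (-1) ^ j * pochhammer \<beta> j"
  proof -
    have "\<alpha> + - z = - (\<beta> + of_nat (j - 1))"
      by (simp add: z_def)
    moreover have "\<beta> + of_nat (j - 1) - of_nat j + 1 = \<beta>"
      using False by (simp add: of_nat_diff)
    ultimately show ?thesis
      unfolding p(2) by (simp only: pochhammer_minus)
  qed
  also have "pochhammer (z + 1) N * z * ((-1) ^ j * pochhammer \<beta> j * fact j / pochhammer z (Suc j)) =
      (-1) ^ j * pochhammer (\<alpha> + \<beta> + 2 * of_nat j) (N - j) * pochhammer \<beta> j * fact j"
  proof -
    have "pochhammer (z + 1) N = pochhammer (z + 1) j * pochhammer (z + 1 + of_nat j) (N - j)"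
      using assms(3) by (rule pochhammer_product)
    moreover have "pochhammer z (Suc j) = z * pochhammer (z + 1) j"
      by (rule pochhammer_rec)
    moreover have "z + 1 + of_nat j = \<alpha> + \<beta> + 2 * of_nat j"
      by (simp flip: zj(2))
    ultimately show ?thesis
      using z0(1) nz[of j] by simp
  qed
  finally show ?thesis
    using assms by (simp add: hahn_weight_pochhammer_sum)
qed

text \<open>Chu--Vandermonde after the reflection (y - x)_n = (-1)^n (x + 1 - y - n)_n.\<close>

lemma pochhammer_vandermonde_minus:
  fixes x y :: "'a :: comm_ring_1"
  shows "pochhammer (y - x) n =
    (\<Sum>i\<le>n. of_nat (n choose i) * (-1) ^ i * pochhammer (y + of_nat i) (n - i) * pochhammer x i)"
proof -
  have "pochhammer (y - x) n = (-1) ^ n * pochhammer (x + (1 - y - of_nat n)) n"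
    using pochhammer_minus[of "x - y" n] by (simp add: algebra_simps)
  also have "\<dots> = (\<Sum>i\<le>n. (-1) ^ n * (of_nat (n choose i) * pochhammer x i * pochhammer (1 - y - of_nat n) (n - i)))"
    by (simp only: pochhammer_binomial_sum sum_distrib_left)
  also have "\<dots> = (\<Sum>i\<le>n. of_nat (n choose i) * (-1) ^ i * pochhammer (y + of_nat i) (n - i) * pochhammer x i)"
  proof (rule sum.cong[OF refl])
    fix i assume "i \<in> {..n}"
    then have i: "i \<le> n"
      by simp
    have "pochhammer (1 - y - of_nat n) (n - i) = (-1) ^ (n - i) * pochhammer (y + of_nat i) (n - i)"
      using pochhammer_minus[of "y + of_nat n - 1" "n - i"] i by (simp add: of_nat_diff algebra_simps)
    moreover have "(-1) ^ n * (-1) ^ (n - i) = ((-1) ^ i :: 'a)"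
      using i by (simp add: minus_one_power_iff)
    moreover have "(-1) ^ n * (of_nat (n choose i) * pochhammer x i * ((-1) ^ (n - i) * P)) =
        of_nat (n choose i) * ((-1) ^ n * (-1) ^ (n - i)) * P * pochhammer x i" for P
      by (simp only: mult_ac)
    ultimately show "(-1) ^ n * (of_nat (n choose i) * pochhammer x i * pochhammer (1 - y - of_nat n) (n - i)) =
        of_nat (n choose i) * (-1) ^ i * pochhammer (y + of_nat i) (n - i) * pochhammer x i"
      by simp
  qed
  finally show ?thesis .
qed

text \<open>A change of basis from (-m)_k to (\<alpha> + m)_l, the functions whose weighted sums
  against \<open>hahn\<close> are known; -m is read as \<alpha> - (\<alpha> + m).\<close>

lemma hahn_expand_pochhammer:
  fixes \<alpha> :: "'a :: field_char_0"
  shows "hahn \<alpha> w N i m = (\<Sum>k\<le>i. \<Sum>l\<le>k. of_nat (i choose k) * pochhammer (of_nat i + w) k / pochhammer \<alpha> k *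
      fact (N - k) * (of_nat (k choose l) * (-1) ^ l * pochhammer (\<alpha> + of_nat l) (k - l)) *
      pochhammer (\<alpha> + of_nat m) l)"
proof -
  have "pochhammer (- of_nat m) k =
      (\<Sum>l\<le>k. of_nat (k choose l) * (-1) ^ l * pochhammer (\<alpha> + of_nat l) (k - l) * pochhammer (\<alpha> + of_nat m) l)" for k
  proof -
    have "pochhammer (- of_nat m) k = pochhammer (\<alpha> - (\<alpha> + of_nat m)) k"
      by simp
    also have "\<dots> = (\<Sum>l\<le>k. of_nat (k choose l) * (-1) ^ l * pochhammer (\<alpha> + of_nat l) (k - l) * pochhammer (\<alpha> + of_nat m) l)"
      by (rule pochhammer_vandermonde_minus)
    finally show ?thesis .
  qed
  then show ?thesis
    by (simp add: hahn_def sum_distrib_left mult_ac)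
qed

lemma hahn_orthogonal:
  fixes \<alpha> \<beta> :: "'a :: field_char_0"
  assumes "\<alpha> \<notin> \<int>\<^sub>\<le>\<^sub>0" "\<alpha> + \<beta> \<notin> \<int>\<^sub>\<le>\<^sub>0" "j \<le> N" "i < j"
  shows "(\<Sum>m\<le>N. hahn_weight \<alpha> \<beta> N m * hahn \<alpha> (\<alpha> + \<beta> - 1) N j m * hahn \<alpha> (\<alpha> + \<beta> - 1) N i m) = 0"
proof -
  let ?w = "\<alpha> + \<beta> - 1"
  define c where "c k l = of_nat (i choose k) * pochhammer (of_nat i + ?w) k / pochhammer \<alpha> k *
      fact (N - k) * (of_nat (k choose l) * (-1) ^ l * pochhammer (\<alpha> + of_nat l) (k - l))" for k l
  have "(\<Sum>m\<le>N. hahn_weight \<alpha> \<beta> N m * hahn \<alpha> ?w N j m * hahn \<alpha> ?w N i m) =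
      (\<Sum>m\<le>N. \<Sum>k\<le>i. \<Sum>l\<le>k. c k l * (hahn_weight \<alpha> \<beta> N m * hahn \<alpha> ?w N j m * pochhammer (\<alpha> + of_nat m) l))"
    by (subst (2) hahn_expand_pochhammer) (simp add: c_def sum_distrib_left mult_ac)
  also have "\<dots> = (\<Sum>k\<le>i. \<Sum>l\<le>k. c k l * (\<Sum>m\<le>N. hahn_weight \<alpha> \<beta> N m * hahn \<alpha> ?w N j m * pochhammer (\<alpha> + of_nat m) l))"
    by (simp only: sum.swap[of _ _ "{..N}"] sum_distrib_left)
  also have "\<dots> = 0"
    using assms by (intro sum.neutral ballI) (simp add: hahn_orthogonal_pochhammer)
  finally show ?thesis .
qed

text \<open>Expanding one of the two factors leaves only k = l = j, since the sums against (\<alpha>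
  + m)_l vanish for l < j. The leading coefficient and the remaining sum both carry the sign
  (-1)^j.\<close>

lemma hahn_norm:
  fixes \<alpha> \<beta> :: "'a :: field_char_0"
  assumes \<alpha>: "\<alpha> \<notin> \<int>\<^sub>\<le>\<^sub>0" and \<beta>: "\<beta> \<notin> \<int>\<^sub>\<le>\<^sub>0" and \<alpha>\<beta>: "\<alpha> + \<beta> \<notin> \<int>\<^sub>\<le>\<^sub>0" and "j \<le> N"
  shows "(\<Sum>m\<le>N. hahn_weight \<alpha> \<beta> N m * hahn \<alpha> (\<alpha> + \<beta> - 1) N j m * hahn \<alpha> (\<alpha> + \<beta> - 1) N j m) =
    1 / hahn_coeff \<alpha> \<beta> j (N - j)"
proof -
  let ?w = "\<alpha> + \<beta> - 1"
  define c where "c k l = of_nat (j choose k) * pochhammer (of_nat j + ?w) k / pochhammer \<alpha> k *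
      fact (N - k) * (of_nat (k choose l) * (-1) ^ l * pochhammer (\<alpha> + of_nat l) (k - l))" for k l
  define S where "S l = (\<Sum>m\<le>N. hahn_weight \<alpha> \<beta> N m * hahn \<alpha> ?w N j m * pochhammer (\<alpha> + of_nat m) l)" for l
  have S0: "S l = 0" if "l < j" for l
    using assms that by (simp add: S_def hahn_orthogonal_pochhammer)
  have "(\<Sum>m\<le>N. hahn_weight \<alpha> \<beta> N m * hahn \<alpha> ?w N j m * hahn \<alpha> ?w N j m) =
      (\<Sum>m\<le>N. \<Sum>k\<le>j. \<Sum>l\<le>k. c k l * (hahn_weight \<alpha> \<beta> N m * hahn \<alpha> ?w N j m * pochhammer (\<alpha> + of_nat m) l))"
    by (subst (2) hahn_expand_pochhammer) (simp add: c_def sum_distrib_left mult_ac)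
  also have "\<dots> = (\<Sum>k\<le>j. \<Sum>l\<le>k. c k l * S l)"
    by (simp only: S_def sum.swap[of _ _ "{..N}"] sum_distrib_left)
  also have "\<dots> = (\<Sum>k\<in>{j}. \<Sum>l\<le>k. c k l * S l)"
    using S0 by (intro sum.mono_neutral_right) (auto intro!: sum.neutral)
  also have "\<dots> = (\<Sum>l\<le>j. c j l * S l)"
    by simp
  also have "\<dots> = (\<Sum>l\<in>{j}. c j l * S l)"
    using S0 by (intro sum.mono_neutral_right) auto
  also have "\<dots> = c j j * S j"
    by simp
  also have "\<dots> = 1 / hahn_coeff \<alpha> \<beta> j (N - j)"
  proof -
    have sign: "(-1 :: 'a) ^ j * (-1) ^ j = 1"
      by (simp flip: power_mult_distrib)
    have "pochhammer (of_nat j + ?w) j = pochhammer (\<alpha> + \<beta> - 1 + of_nat j) j"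
      by (simp add: add_ac)
    then have "c j j * S j = (-1) ^ j * (-1) ^ j * (pochhammer (\<alpha> + \<beta> - 1 + of_nat j) j / pochhammer \<alpha> j *
        fact (N - j) * pochhammer (\<alpha> + \<beta> + 2 * of_nat j) (N - j) * pochhammer \<beta> j * fact j)"
      unfolding c_def S_def hahn_pochhammer_degree[OF \<alpha> \<alpha>\<beta> \<open>j \<le> N\<close>]
      by simp
    then show ?thesis
      unfolding sign hahn_coeff_def by (simp add: mult_ac)
  qed
  finally show ?thesis .
qed

text \<open>A one-sided inverse of a square matrix is two-sided.\<close>
lemma sum_orthogonality_dual:
  fixes f g :: "nat \<Rightarrow> nat \<Rightarrow> 'a :: field"
  assumes fg: "\<And>i j. i \<le> N \<Longrightarrow> j \<le> N \<Longrightarrow> (\<Sum>m\<le>N. f i m * g m j) = (if i = j then 1 else 0)"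
    and "m \<le> N" "n \<le> N"
  shows "(\<Sum>j\<le>N. g m j * f j n) = (if m = n then 1 else 0)"
proof -
  let ?F = "mat (Suc N) (Suc N) (\<lambda>(i, j). f i j)"
  let ?G = "mat (Suc N) (Suc N) (\<lambda>(i, j). g i j)"
  have "?F * ?G = 1\<^sub>m (Suc N)"
    using fg by (intro eq_matI) (auto simp: scalar_prod_def atLeast0LessThan lessThan_Suc_atMost less_Suc_eq_le)
  then have "?G * ?F = 1\<^sub>m (Suc N)"
    by (rule mat_mult_left_right_inverse[rotated 2]) auto
  then have "(?G * ?F) $$ (m, n) = 1\<^sub>m (Suc N) $$ (m, n)"
    by simp
  then show ?thesis
    using assms by (simp add: scalar_prod_def atLeast0LessThan lessThan_Suc_atMost less_Suc_eq_le)
qed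

text \<open>Orthogonality says that the matrices \<open>f\<close> (coefficient times polynomial) and
  \<open>g\<close> (weight times polynomial) satisfy f g = 1. Reading g f = 1 entrywise and dividing
  by the weight gives the dual relation.\<close>

lemma hahn_dual_orthogonal:
  fixes \<alpha> \<beta> :: "'a :: field_char_0"
  assumes \<alpha>: "\<alpha> \<notin> \<int>\<^sub>\<le>\<^sub>0" and \<beta>: "\<beta> \<notin> \<int>\<^sub>\<le>\<^sub>0" and \<alpha>\<beta>: "\<alpha> + \<beta> \<notin> \<int>\<^sub>\<le>\<^sub>0" and "m \<le> N" "n \<le> N"
  shows "(\<Sum>j\<le>N. hahn_coeff \<alpha> \<beta> j (N - j) * hahn \<alpha> (\<alpha> + \<beta> - 1) N j m * hahn \<alpha> (\<alpha> + \<beta> - 1) N j n) =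
    (if m = n then 1 / hahn_weight \<alpha> \<beta> N m else 0)"
proof -
  let ?q = "hahn \<alpha> (\<alpha> + \<beta> - 1) N"
  define f where "f i m = hahn_coeff \<alpha> \<beta> i (N - i) * ?q i m" for i m
  define g where "g m j = hahn_weight \<alpha> \<beta> N m * ?q j m" for m j
  have coeff: "hahn_coeff \<alpha> \<beta> i (N - i) \<noteq> 0" for i
  proof -
    \<comment> \<open>For i = 0 the symbol is empty; for i > 0 its base is \<alpha> + \<beta> plus a
      natural number.\<close>
    have "pochhammer (\<alpha> + \<beta> - 1 + of_nat i) i \<noteq> 0"
    proof (cases i)
      case (Suc i')
      then show ?thesis
        using pochhammer_nonzero[OF \<alpha>\<beta>, of i' i] by (simp add: algebra_simps)
    qed simp
    moreover have "pochhammer (\<alpha> + \<beta> + 2 * of_nat i) (N - i) \<noteq> 0"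
      using pochhammer_nonzero[OF \<alpha>\<beta>, of "2 * i" "N - i"] by simp
    ultimately show ?thesis
      using pochhammer_nonzero[OF \<alpha>, of 0] pochhammer_nonzero[OF \<beta>, of 0] by (simp add: hahn_coeff_def)
  qed
  have weight: "hahn_weight \<alpha> \<beta> N m \<noteq> 0"
    using pochhammer_nonzero[OF \<alpha>, of 0] pochhammer_nonzero[OF \<beta>, of 0] by (simp add: hahn_weight_def)
  have "(\<Sum>m\<le>N. f i m * g m j) = (if i = j then 1 else 0)" if "i \<le> N" "j \<le> N" for i j
  proof -
    have "(\<Sum>m\<le>N. f i m * g m j) =
        hahn_coeff \<alpha> \<beta> i (N - i) * (\<Sum>m\<le>N. hahn_weight \<alpha> \<beta> N m * ?q j m * ?q i m)"
      by (simp add: f_def g_def sum_distrib_left mult_ac)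
    also have "(\<Sum>m\<le>N. hahn_weight \<alpha> \<beta> N m * ?q j m * ?q i m) =
        (if i = j then 1 / hahn_coeff \<alpha> \<beta> i (N - i) else 0)"
    proof (cases i j rule: linorder_cases)
      case greater
      then show ?thesis
        using hahn_orthogonal[OF \<alpha> \<alpha>\<beta>, of i N j] that by (simp add: mult_ac)
    qed (use that in \<open>simp_all add: hahn_orthogonal[OF \<alpha> \<alpha>\<beta>] hahn_norm[OF \<alpha> \<beta> \<alpha>\<beta>]\<close>)
    finally show ?thesis
      using coeff by simp
  qed
  then have dual: "(\<Sum>j\<le>N. g m j * f j n) = (if m = n then 1 else 0)"
    using assms(4,5) by (rule sum_orthogonality_dual)
  have expand: "(\<Sum>j\<le>N. g m j * f j n) = hahn_weight \<alpha> \<beta> N m *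
      (\<Sum>j\<le>N. hahn_coeff \<alpha> \<beta> j (N - j) * ?q j m * ?q j n)"
    by (simp add: f_def g_def sum_distrib_left mult_ac)
  show ?thesis
    using weight dual[unfolded expand] by (simp add: nonzero_eq_divide_eq mult.commute split: if_splits)
qed

subsection \<open>The coefficient identity\<close>

text \<open>
  The series \<open>\<^sub>3F\<^sub>2(-j, j + w, z; \<alpha>, s; 1)\<close>, with \<open>(-j)\<^sub>k / k!\<close> written as \<open>(-1)\<^sup>k (j choose k)\<close>.
\<close>
definition hahn_3F2 :: "'a :: field_char_0 \<Rightarrow> 'a \<Rightarrow> 'a \<Rightarrow> nat \<Rightarrow> 'a \<Rightarrow> 'a" where
  "hahn_3F2 \<alpha> s w j z = (\<Sum>k\<le>j. (-1) ^ k * of_nat (j choose k) * pochhammer (of_nat j + w) k *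
     pochhammer z k / (pochhammer \<alpha> k * pochhammer s k))"

text \<open>Since (s)_N / (s)_k = (s + k)_(N-k), the k-th term contains (z)_k (s + k)_(N-k), and
  \<open>pochhammer_vandermonde_shifted\<close> with x = z and y = s - z is read backwards. The
  coefficients \<open>hahn\<close> are free of s and z, so expansions with different s and z can be
  paired.\<close>

lemma hahn_3F2_expand:
  fixes s z :: "'a :: field_char_0"
  assumes s: "s \<notin> \<int>\<^sub>\<le>\<^sub>0" and "j \<le> N"
  shows "pochhammer s N * hahn_3F2 \<alpha> s w j z =
    (\<Sum>m\<le>N. pochhammer z m * pochhammer (s - z) (N - m) / (fact m * fact (N - m)) * hahn \<alpha> w N j m)"
proof -
  have "(\<Sum>m\<le>N. pochhammer z m * pochhammer (s - z) (N - m) / (fact m * fact (N - m)) * hahn \<alpha> w N j m) =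
    (\<Sum>m\<le>N. \<Sum>k\<le>j. of_nat (j choose k) * pochhammer (of_nat j + w) k / pochhammer \<alpha> k * fact (N - k) *
      (pochhammer z m * pochhammer (s - z) (N - m) * pochhammer (- of_nat m) k / (fact m * fact (N - m))))"
    by (simp add: hahn_def sum_distrib_left mult_ac)
  also have "\<dots> = (\<Sum>k\<le>j. of_nat (j choose k) * pochhammer (of_nat j + w) k / pochhammer \<alpha> k * fact (N - k) *
      (\<Sum>m\<le>N. pochhammer z m * pochhammer (s - z) (N - m) * pochhammer (- of_nat m) k / (fact m * fact (N - m))))"
    by (subst sum.swap) (simp only: sum_distrib_left)
  also have "\<dots> = (\<Sum>k\<le>j. pochhammer s N * ((-1) ^ k * of_nat (j choose k) * pochhammer (of_nat j + w) k *
     pochhammer z k / (pochhammer \<alpha> k * pochhammer s k)))"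
  proof (rule sum.cong[OF refl])
    fix k assume "k \<in> {..j}"
    then have k: "k \<le> N"
      using assms by simp
    have arrange: "c * p / q * F * (e * Z * V / F) = S * V * (e * c * p * Z / (q * S))"
      if "F \<noteq> 0" "S \<noteq> 0" for c p q F e Z V S :: 'a
      using that by simp
    have "pochhammer s k \<noteq> 0"
      using pochhammer_nonzero[OF s, of 0 k] by simp
    moreover have "pochhammer (z + (s - z) + of_nat k) (N - k) = pochhammer (s + of_nat k) (N - k)"
      by simp
    moreover have "pochhammer s N = pochhammer s k * pochhammer (s + of_nat k) (N - k)"
      using k by (rule pochhammer_product)
    ultimately show "of_nat (j choose k) * pochhammer (of_nat j + w) k / pochhammer \<alpha> k * fact (N - k) *
      (\<Sum>m\<le>N. pochhammer z m * pochhammer (s - z) (N - m) * pochhammer (- of_nat m) k / (fact m * fact (N - m))) =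
      pochhammer s N * ((-1) ^ k * of_nat (j choose k) * pochhammer (of_nat j + w) k *
     pochhammer z k / (pochhammer \<alpha> k * pochhammer s k))"
      by (simp only: pochhammer_vandermonde_shifted[OF k] arrange[OF fact_nonzero])
  qed
  finally show ?thesis
    by (simp only: hahn_3F2_def sum_distrib_left)
qed

lemma hahn_3F2_bilinear:
  fixes \<alpha> \<beta> s t A B :: "'a :: field_char_0"
  assumes \<alpha>: "\<alpha> \<notin> \<int>\<^sub>\<le>\<^sub>0" and \<beta>: "\<beta> \<notin> \<int>\<^sub>\<le>\<^sub>0" and \<alpha>\<beta>: "\<alpha> + \<beta> \<notin> \<int>\<^sub>\<le>\<^sub>0"
    and s: "s \<notin> \<int>\<^sub>\<le>\<^sub>0" and t: "t \<notin> \<int>\<^sub>\<le>\<^sub>0"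
  shows "(\<Sum>j\<le>N. hahn_coeff \<alpha> \<beta> j (N - j) * (pochhammer s N * hahn_3F2 \<alpha> s (\<alpha> + \<beta> - 1) j A) *
      (pochhammer t N * hahn_3F2 \<alpha> t (\<alpha> + \<beta> - 1) j B)) =
    (\<Sum>m\<le>N. pochhammer A m * pochhammer B m / (pochhammer \<alpha> m * fact m) *
      (pochhammer (s - A) (N - m) * pochhammer (t - B) (N - m) / (pochhammer \<beta> (N - m) * fact (N - m))))"
proof -
  let ?w = "\<alpha> + \<beta> - 1"
  define c where "c j = hahn_coeff \<alpha> \<beta> j (N - j)" for j
  define a where "a m = pochhammer A m * pochhammer (s - A) (N - m) / (fact m * fact (N - m))" for m
  define b where "b m = pochhammer B m * pochhammer (t - B) (N - m) / (fact m * fact (N - m))" for m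
  have "(\<Sum>j\<le>N. c j * (pochhammer s N * hahn_3F2 \<alpha> s ?w j A) * (pochhammer t N * hahn_3F2 \<alpha> t ?w j B)) =
      (\<Sum>j\<le>N. c j * (\<Sum>m\<le>N. a m * hahn \<alpha> ?w N j m) * (\<Sum>n\<le>N. b n * hahn \<alpha> ?w N j n))"
    using s t by (intro sum.cong) (simp_all add: hahn_3F2_expand a_def b_def)
  also have "\<dots> = (\<Sum>j\<le>N. \<Sum>m\<le>N. \<Sum>n\<le>N. a m * b n * (c j * hahn \<alpha> ?w N j m * hahn \<alpha> ?w N j n))"
    by (simp add: sum_distrib_left sum_distrib_right mult_ac)
  also have "\<dots> = (\<Sum>m\<le>N. \<Sum>j\<le>N. \<Sum>n\<le>N. a m * b n * (c j * hahn \<alpha> ?w N j m * hahn \<alpha> ?w N j n))"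
    by (rule sum.swap)
  also have "\<dots> = (\<Sum>m\<le>N. \<Sum>n\<le>N. \<Sum>j\<le>N. a m * b n * (c j * hahn \<alpha> ?w N j m * hahn \<alpha> ?w N j n))"
    by (intro sum.cong[OF refl] sum.swap)
  \<comment> \<open>With the sum over j innermost, dual orthogonality removes every pair with m and
    n distinct.\<close>
  also have "\<dots> = (\<Sum>m\<le>N. \<Sum>n\<le>N. if n = m then a m * b m / hahn_weight \<alpha> \<beta> N m else 0)"
  proof (intro sum.cong[OF refl])
    fix m n assume "m \<in> {..N}" "n \<in> {..N}"
    then have "(\<Sum>j\<le>N. c j * hahn \<alpha> ?w N j m * hahn \<alpha> ?w N j n) =
        (if m = n then 1 / hahn_weight \<alpha> \<beta> N m else 0)"
      unfolding c_def by (intro hahn_dual_orthogonal[OF \<alpha> \<beta> \<alpha>\<beta>]) auto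
    then show "(\<Sum>j\<le>N. a m * b n * (c j * hahn \<alpha> ?w N j m * hahn \<alpha> ?w N j n)) =
        (if n = m then a m * b m / hahn_weight \<alpha> \<beta> N m else 0)"
      by (simp flip: sum_distrib_left)
  qed
  also have "\<dots> = (\<Sum>m\<le>N. a m * b m / hahn_weight \<alpha> \<beta> N m)"
    by (intro sum.cong) auto
  also have "\<dots> = (\<Sum>m\<le>N. pochhammer A m * pochhammer B m / (pochhammer \<alpha> m * fact m) *
      (pochhammer (s - A) (N - m) * pochhammer (t - B) (N - m) / (pochhammer \<beta> (N - m) * fact (N - m))))"
    by (simp add: a_def b_def hahn_weight_def mult_ac)
  finally show ?thesis
    by (simp only: c_def)
qed

subsection \<open>Convergence\<close>

text \<open>Ratio test: the quotient of consecutive terms tends to z.\<close>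

lemma summable_norm_2F1:
  fixes a b c z :: "'a :: {real_normed_field, banach}"
  assumes c: "c \<notin> \<int>\<^sub>\<le>\<^sub>0" and z: "norm z < 1"
  shows "summable (\<lambda>n. norm (pochhammer a n * pochhammer b n / (pochhammer c n * fact n) * z ^ n))"
proof -
  define f where "f n = pochhammer a n * pochhammer b n / (pochhammer c n * fact n) * z ^ n" for n
  have lim: "(\<lambda>n. (u + of_nat n) / (v + of_nat n)) \<longlonglongrightarrow> 1" for u v :: 'a
  proof -
    have "(\<lambda>n. (u / of_nat n + 1) / (v / of_nat n + 1)) \<longlonglongrightarrow> (0 + 1) / (0 + 1)"
      by (intro tendsto_intros) auto
    moreover have "eventually (\<lambda>n. (u / of_nat n + 1) / (v / of_nat n + 1) =
        (u + of_nat n) / (v + of_nat n)) sequentially"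
      using eventually_gt_at_top[of 0]
    proof eventually_elim
      case (elim n)
      have "(u / of_nat n + 1) = (u + of_nat n) / of_nat n" "(v / of_nat n + 1) = (v + of_nat n) / of_nat n"
        using elim by (simp_all add: add_divide_distrib)
      then show ?case
        using elim by simp
    qed
    ultimately show ?thesis
      by (simp add: filterlim_cong)
  qed
  define q where "q n = (a + of_nat n) / (c + of_nat n) * ((b + of_nat n) / (1 + of_nat n)) * z" for n
  have step: "f (Suc n) = q n * f n" for n
    by (simp add: f_def q_def pochhammer_Suc mult_ac)
  have "(\<lambda>n. norm (q n)) \<longlonglongrightarrow> norm (1 * 1 * z)"
    unfolding q_def by (intro tendsto_intros lim)
  moreover obtain \<rho> where \<rho>: "norm z < \<rho>" "\<rho> < 1"
    using z dense by blast
  ultimately have "eventually (\<lambda>n. norm (q n) < \<rho>) sequentially"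
    by (intro order_tendstoD) auto
  then obtain M where M: "norm (q n) < \<rho>" if "n \<ge> M" for n
    by (auto simp: eventually_at_top_linorder)
  have "summable (\<lambda>n. norm (f n))"
  proof (rule summable_ratio_test[OF \<rho>(2), of M])
    fix n assume "n \<ge> M"
    then have "norm (q n) \<le> \<rho>"
      using M less_imp_le by blast
    then show "norm (norm (f (Suc n))) \<le> \<rho> * norm (norm (f n))"
      by (simp add: step norm_mult mult_right_mono)
  qed
  then show ?thesis
    by (simp only: f_def)
qed

text \<open>The pairs (n, j) with j \<le> n are in bijection with all pairs (j, k) through k = n -
  j. Absolute summability on the antidiagonals is thus absolute summability over all pairs, and the
  total can be computed by antidiagonals or by rows.\<close>

lemma sums_antidiagonal:
  fixes f :: "nat \<Rightarrow> nat \<Rightarrow> 'a :: banach"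
  assumes summable: "summable (\<lambda>n. \<Sum>j\<le>n. norm (f j (n - j)))"
  shows "(\<lambda>j. \<Sum>k. f j k) sums (\<Sum>n. \<Sum>j\<le>n. f j (n - j))"
proof -
  define T where "T = (SIGMA n:UNIV. {..n :: nat})"
  define h where "h = (\<lambda>(n :: nat, j). (j, n - j))"
  have h: "bij_betw h T UNIV"
    by (rule bij_betwI[where g = "\<lambda>(j, k). (j + k, j)"]) (auto simp: h_def T_def)
  define F where "F = (\<lambda>(j, k). f j k)"
  have "(\<lambda>p. norm (F (h p))) summable_on T"
    unfolding T_def
  proof (rule summable_on_SigmaI)
    show "((\<lambda>j. norm (F (h (n, j)))) has_sum (\<Sum>j\<le>n. norm (f j (n - j)))) {..n}" for n
      by (rule has_sum_finiteI) (auto simp: F_def h_def)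
    show "(\<lambda>n. \<Sum>j\<le>n. norm (f j (n - j))) summable_on UNIV"
      using summable by (intro summable_nonneg_imp_summable_on sum_nonneg) auto
  qed auto
  then have abs: "F abs_summable_on UNIV"
    using summable_on_reindex_bij_betw[OF h, of "\<lambda>p. norm (F p)"] by simp
  then obtain S where S: "(F has_sum S) UNIV"
    using abs_summable_summable summable_on_def by blast
  then have "((\<lambda>p. F (h p)) has_sum S) T"
    using has_sum_reindex_bij_betw[OF h] by blast
  then have "((\<lambda>n. \<Sum>j\<le>n. f j (n - j)) has_sum S) UNIV"
    unfolding T_def by (rule has_sum_SigmaD) (auto intro!: has_sum_finiteI simp: F_def h_def)
  then have S_eq: "(\<Sum>n. \<Sum>j\<le>n. f j (n - j)) = S"
    by (intro sums_unique[symmetric] has_sum_imp_sums)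
  \<comment> \<open>The value of \<open>suminf\<close> means something only on a convergent row, so
    each row is first shown to be summable.\<close>
  have row: "(f j has_sum (\<Sum>k. f j k)) UNIV" for j
  proof -
    have "(\<lambda>p. norm (F p)) summable_on Sigma UNIV (\<lambda>_. UNIV)"
      using abs by simp
    then have "(\<lambda>k. norm (F (j, k))) summable_on UNIV"
      by (subst (asm) Infinite_Sum.abs_summable_on_Sigma_iff) blast
    then obtain s where s: "(f j has_sum s) UNIV"
      unfolding F_def using abs_summable_summable summable_on_def by fastforce
    then have "s = (\<Sum>k. f j k)"
      by (intro sums_unique has_sum_imp_sums)
    with s show ?thesis
      by simp
  qed
  have "((\<lambda>j. \<Sum>k. f j k) has_sum S) UNIV"
    by (rule has_sum_SigmaD[where f = F and B = "\<lambda>_. UNIV"]) (use S row in \<open>auto simp: F_def\<close>)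
  then show ?thesis
    unfolding S_eq by (rule has_sum_imp_sums)
qed

lemma positive_notin_nonpos_Ints:
  fixes z :: complex
  assumes "Re z > 0"
  shows "z \<notin> \<int>\<^sub>\<le>\<^sub>0"
  using assms by (auto elim!: nonpos_Ints_cases')

lemma hahn_coeff_of_real:
  "hahn_coeff (of_real \<alpha> :: complex) (of_real \<beta>) j k = of_real (hahn_coeff \<alpha> \<beta> j k)"
  by (simp add: hahn_coeff_def flip: pochhammer_of_real)

lemma hahn_coeff_nonneg:
  fixes \<alpha> \<beta> :: real
  assumes "\<alpha> > 0" "\<beta> > 0"
  shows "hahn_coeff \<alpha> \<beta> j k \<ge> 0"
proof -
  \<comment> \<open>For j = 0 the base may be negative, but the symbol is then 1; for j > 0 the base
    is positive.\<close>
  have "pochhammer (\<alpha> + \<beta> - 1 + real j) j \<ge> 0"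
    using assms by (cases j) (auto intro!: less_imp_le[OF pochhammer_pos])
  moreover have "pochhammer (\<alpha> + \<beta> + 2 * real j) k \<ge> 0"
    using assms by (intro less_imp_le[OF pochhammer_pos]) auto
  ultimately show ?thesis
    using assms by (simp add: hahn_coeff_def pochhammer_pos less_imp_le)
qed

lemma hypergeom_2F1: "hypergeom [a, b] [c] z = (\<Sum>n. pochhammer a n * pochhammer b n / (pochhammer c n * fact n) * z ^ n)"
  by (simp add: hypergeom_def)

section \<open>Summing the bilinear series by antidiagonals and by rows\<close>

text \<open>The Cauchy product of the two 2F1 series, with its coefficients rewritten by
  \<open>hahn_3F2_bilinear\<close>. Terms are still grouped by N; grouping them by j requires
  absolute summability.\<close>

lemma hahn_3F2_antidiagonal_sums:
  fixes \<alpha> \<beta> s t A B r :: complex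
  assumes \<alpha>: "\<alpha> \<notin> \<int>\<^sub>\<le>\<^sub>0" and \<beta>: "\<beta> \<notin> \<int>\<^sub>\<le>\<^sub>0" and \<alpha>\<beta>: "\<alpha> + \<beta> \<notin> \<int>\<^sub>\<le>\<^sub>0"
    and s: "s \<notin> \<int>\<^sub>\<le>\<^sub>0" and t: "t \<notin> \<int>\<^sub>\<le>\<^sub>0" and r: "norm r < 1"
  shows "(\<lambda>N. \<Sum>j\<le>N. hahn_coeff \<alpha> \<beta> j (N - j) * (pochhammer s N * hahn_3F2 \<alpha> s (\<alpha> + \<beta> - 1) j A) *
      (pochhammer t N * hahn_3F2 \<alpha> t (\<alpha> + \<beta> - 1) j B) * r ^ N)
    sums (hypergeom [A, B] [\<alpha>] r * hypergeom [s - A, t - B] [\<beta>] r)"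
proof -
  define u where "u m = pochhammer A m * pochhammer B m / (pochhammer \<alpha> m * fact m) * r ^ m" for m
  define v where "v m = pochhammer (s - A) m * pochhammer (t - B) m / (pochhammer \<beta> m * fact m) * r ^ m" for m
  have "(\<Sum>m\<le>N. u m * v (N - m)) = (\<Sum>j\<le>N. hahn_coeff \<alpha> \<beta> j (N - j) *
      (pochhammer s N * hahn_3F2 \<alpha> s (\<alpha> + \<beta> - 1) j A) *
      (pochhammer t N * hahn_3F2 \<alpha> t (\<alpha> + \<beta> - 1) j B) * r ^ N)" for N
    unfolding sum_distrib_right[symmetric] hahn_3F2_bilinear[OF \<alpha> \<beta> \<alpha>\<beta> s t]
    unfolding sum_distrib_right
  proof (rule sum.cong[OF refl])
    fix m assume "m \<in> {..N}"
    then have "r ^ N = r ^ m * r ^ (N - m)"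
      by (simp flip: power_add)
    then show "u m * v (N - m) = pochhammer A m * pochhammer B m / (pochhammer \<alpha> m * fact m) *
      (pochhammer (s - A) (N - m) * pochhammer (t - B) (N - m) / (pochhammer \<beta> (N - m) * fact (N - m))) * r ^ N"
      by (simp only: u_def v_def mult_ac)
  qed
  moreover have "(\<lambda>N. \<Sum>m\<le>N. u m * v (N - m)) sums
      (hypergeom [A, B] [\<alpha>] r * hypergeom [s - A, t - B] [\<beta>] r)"
    unfolding hypergeom_2F1 u_def v_def using r \<alpha> \<beta>
    by (intro Cauchy_product_sums summable_norm_2F1) auto
  ultimately show ?thesis
    by simp
qed

text \<open>The antidiagonal series at t = \<open>cnj s\<close>, B = \<open>cnj z\<close> and r =
  \<rho>. As \<alpha> and \<beta> are real, the two 3F2 factors are conjugate and each product is a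
  squared modulus.\<close>

lemma summable_hahn_3F2_square:
  fixes \<alpha> \<beta> \<rho> :: real and s z :: complex
  assumes \<alpha>: "\<alpha> > 0" and \<beta>: "\<beta> > 0" and s: "s \<notin> \<int>\<^sub>\<le>\<^sub>0" and \<rho>: "0 \<le> \<rho>" "\<rho> < 1"
  shows "summable (\<lambda>N. \<Sum>j\<le>N. hahn_coeff \<alpha> \<beta> j (N - j) *
    (norm (pochhammer s N * hahn_3F2 (of_real \<alpha>) s (of_real \<alpha> + of_real \<beta> - 1) j z))\<^sup>2 * \<rho> ^ N)"
proof -
  let ?F = "hahn_3F2 (of_real \<alpha>) s (of_real \<alpha> + of_real \<beta> - 1)"
  have notin: "complex_of_real \<alpha> \<notin> \<int>\<^sub>\<le>\<^sub>0" "complex_of_real \<beta> \<notin> \<int>\<^sub>\<le>\<^sub>0" "complex_of_real \<alpha> + complex_of_real \<beta> \<notin> \<int>\<^sub>\<le>\<^sub>0"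
    using \<alpha> \<beta> by (auto intro!: positive_notin_nonpos_Ints)
  have cs: "cnj s \<notin> \<int>\<^sub>\<le>\<^sub>0"
  proof
    assume "cnj s \<in> \<int>\<^sub>\<le>\<^sub>0"
    then obtain n where "cnj s = - of_nat n"
      by (rule nonpos_Ints_cases')
    then have "s = - of_nat n"
      by (metis complex_cnj_cnj complex_cnj_minus complex_cnj_of_nat)
    with s show False
      by simp
  qed
  have cF: "hahn_3F2 (of_real \<alpha>) (cnj s) (of_real \<alpha> + of_real \<beta> - 1) j (cnj z) = cnj (?F j z)" for j
    by (simp add: hahn_3F2_def)
  have "summable (\<lambda>N. \<Sum>j\<le>N. hahn_coeff (of_real \<alpha>) (of_real \<beta>) j (N - j) * (pochhammer s N * ?F j z) *
      (pochhammer (cnj s) N * hahn_3F2 (of_real \<alpha>) (cnj s) (of_real \<alpha> + of_real \<beta> - 1) j (cnj z)) *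
      of_real \<rho> ^ N)"
    using \<rho> by (intro sums_summable[OF hahn_3F2_antidiagonal_sums[OF notin s cs]]) auto
  also have "(\<lambda>N. \<Sum>j\<le>N. hahn_coeff (of_real \<alpha>) (of_real \<beta>) j (N - j) * (pochhammer s N * ?F j z) *
      (pochhammer (cnj s) N * hahn_3F2 (of_real \<alpha>) (cnj s) (of_real \<alpha> + of_real \<beta> - 1) j (cnj z)) *
      of_real \<rho> ^ N) = (\<lambda>N. complex_of_real (\<Sum>j\<le>N. hahn_coeff \<alpha> \<beta> j (N - j) *
      (norm (pochhammer s N * ?F j z))\<^sup>2 * \<rho> ^ N))"
    unfolding of_real_sum cF hahn_coeff_of_real complex_cnj_pochhammer[symmetric] complex_cnj_mult[symmetric]
    by (intro ext sum.cong[OF refl])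
      (simp only: of_real_mult complex_norm_square of_real_power[of \<rho>] mult.assoc)
  finally show ?thesis
    by (simp only: summable_of_real_iff)
qed

text \<open>The terms are dominated by two series of squares, one for (s, A) and one for (t, B),
  both taken at \<rho> = \<open>norm r\<close>; \<open>sums_antidiagonal\<close> then regroups by
  j.\<close>

lemma hahn_3F2_sums:
  fixes \<alpha> \<beta> :: real and s t A B r :: complex
  assumes \<alpha>: "\<alpha> > 0" and \<beta>: "\<beta> > 0" and s: "s \<notin> \<int>\<^sub>\<le>\<^sub>0" and t: "t \<notin> \<int>\<^sub>\<le>\<^sub>0" and r: "norm r < 1"
  shows "(\<lambda>j. \<Sum>k. of_real (hahn_coeff \<alpha> \<beta> j k) *
      (pochhammer s (j + k) * hahn_3F2 (of_real \<alpha>) s (of_real \<alpha> + of_real \<beta> - 1) j A) *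
      (pochhammer t (j + k) * hahn_3F2 (of_real \<alpha>) t (of_real \<alpha> + of_real \<beta> - 1) j B) * r ^ (j + k))
    sums (hypergeom [A, B] [of_real \<alpha>] r * hypergeom [s - A, t - B] [of_real \<beta>] r)"
proof -
  let ?w = "complex_of_real \<alpha> + of_real \<beta> - 1"
  define S where "S j n = pochhammer s n * hahn_3F2 (of_real \<alpha>) s ?w j A" for j n
  define T where "T j n = pochhammer t n * hahn_3F2 (of_real \<alpha>) t ?w j B" for j n
  define f where "f j k = of_real (hahn_coeff \<alpha> \<beta> j k) * S j (j + k) * T j (j + k) * r ^ (j + k)" for j k
  have notin: "complex_of_real \<alpha> \<notin> \<int>\<^sub>\<le>\<^sub>0" "complex_of_real \<beta> \<notin> \<int>\<^sub>\<le>\<^sub>0" "complex_of_real \<alpha> + complex_of_real \<beta> \<notin> \<int>\<^sub>\<le>\<^sub>0"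
    using \<alpha> \<beta> by (auto intro!: positive_notin_nonpos_Ints)
  have "(\<Sum>j\<le>N. f j (N - j)) = (\<Sum>j\<le>N. hahn_coeff (of_real \<alpha>) (of_real \<beta>) j (N - j) * S j N * T j N * r ^ N)" for N
    by (simp add: f_def hahn_coeff_of_real)
  then have total: "(\<Sum>N. \<Sum>j\<le>N. f j (N - j)) =
      hypergeom [A, B] [of_real \<alpha>] r * hypergeom [s - A, t - B] [of_real \<beta>] r"
    using hahn_3F2_antidiagonal_sums[OF notin s t r, of A B] by (simp add: S_def T_def sums_iff)
  have "summable (\<lambda>N. \<Sum>j\<le>N. norm (f j (N - j)))"
  proof (rule summable_comparison_test')
    show "summable (\<lambda>N. (\<Sum>j\<le>N. hahn_coeff \<alpha> \<beta> j (N - j) * (norm (S j N))\<^sup>2 * norm r ^ N) +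
        (\<Sum>j\<le>N. hahn_coeff \<alpha> \<beta> j (N - j) * (norm (T j N))\<^sup>2 * norm r ^ N))"
      unfolding S_def T_def using \<alpha> \<beta> s t r by (intro summable_add summable_hahn_3F2_square) auto
    fix N :: nat
    show "norm (\<Sum>j\<le>N. norm (f j (N - j))) \<le>
        (\<Sum>j\<le>N. hahn_coeff \<alpha> \<beta> j (N - j) * (norm (S j N))\<^sup>2 * norm r ^ N) +
        (\<Sum>j\<le>N. hahn_coeff \<alpha> \<beta> j (N - j) * (norm (T j N))\<^sup>2 * norm r ^ N)"
      unfolding sum.distrib[symmetric] real_norm_def
    proof (subst abs_of_nonneg)
      show "(\<Sum>j\<le>N. norm (f j (N - j))) \<le> (\<Sum>j\<le>N. hahn_coeff \<alpha> \<beta> j (N - j) * (norm (S j N))\<^sup>2 * norm r ^ N +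
        hahn_coeff \<alpha> \<beta> j (N - j) * (norm (T j N))\<^sup>2 * norm r ^ N)"
      proof (rule sum_mono)
        fix j assume "j \<in> {..N}"
        then have "norm (f j (N - j)) =
            hahn_coeff \<alpha> \<beta> j (N - j) * norm r ^ N * (norm (S j N) * norm (T j N))"
          using hahn_coeff_nonneg[OF \<alpha> \<beta>] by (simp add: f_def norm_mult norm_power)
        also have "\<dots> \<le> hahn_coeff \<alpha> \<beta> j (N - j) * norm r ^ N * ((norm (S j N))\<^sup>2 + (norm (T j N))\<^sup>2)"
        proof (rule mult_left_mono)
          have "2 * norm (S j N) * norm (T j N) \<le> (norm (S j N))\<^sup>2 + (norm (T j N))\<^sup>2"
            by (rule sum_squares_bound)
          moreover have "0 \<le> norm (S j N) * norm (T j N)"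
            by simp
          ultimately show "norm (S j N) * norm (T j N) \<le> (norm (S j N))\<^sup>2 + (norm (T j N))\<^sup>2"
            by linarith
        qed (use hahn_coeff_nonneg[OF \<alpha> \<beta>] in auto)
        finally show "norm (f j (N - j)) \<le> hahn_coeff \<alpha> \<beta> j (N - j) * (norm (S j N))\<^sup>2 * norm r ^ N +
            hahn_coeff \<alpha> \<beta> j (N - j) * (norm (T j N))\<^sup>2 * norm r ^ N"
          by (simp add: algebra_simps)
      qed
    qed (simp add: sum_nonneg)
  qed
  from sums_antidiagonal[OF this] show ?thesis
    unfolding total by (simp only: f_def S_def T_def)
qed

section \<open>Continuous Hahn polynomials and their generating function\<close>

text \<open>The infinite series stops at k = j because (-j)_k vanishes beyond. Both sides have the
  same denominators, so the terms agree even where these are zero.\<close>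

lemma cont_hahn_eq_hahn_3F2:
  "cont_hahn j x a b c d = \<i> ^ j * pochhammer (a + c) j * pochhammer (a + d) j / fact j *
     hahn_3F2 (a + c) (a + d) (a + b + c + d - 1) j (a + \<i> * of_real x)"
proof -
  let ?f = "\<lambda>k. pochhammer (- of_nat j) k * (pochhammer (of_nat j + a + b + c + d - 1) k * pochhammer (a + \<i> * of_real x) k) /
      (pochhammer (a + c) k * pochhammer (a + d) k) / fact k"
  have "hypergeom [- of_nat j, of_nat j + a + b + c + d - 1, a + \<i> * of_real x] [a + c, a + d] 1 = (\<Sum>k. ?f k)"
    by (simp add: hypergeom_def)
  also have "\<dots> = (\<Sum>k\<le>j. ?f k)"
    by (intro suminf_finite) (auto simp: pochhammer_of_nat_eq_0_lemma)
  also have "\<dots> = hahn_3F2 (a + c) (a + d) (a + b + c + d - 1) j (a + \<i> * of_real x)"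
    unfolding hahn_3F2_def
  proof (rule sum.cong[OF refl])
    fix k
    have "(-1) ^ k * of_nat (j choose k) = (pochhammer (- of_nat j) k / fact k :: complex)"
      by (simp add: binomial_gbinomial gbinomial_pochhammer flip: power_mult_distrib mult.assoc)
    moreover have "pochhammer (of_nat j + (a + b + c + d - 1)) k = pochhammer (of_nat j + a + b + c + d - 1) k"
      by (simp add: algebra_simps)
    ultimately show "?f k = (-1) ^ k * of_nat (j choose k) * pochhammer (of_nat j + (a + b + c + d - 1)) k *
        pochhammer (a + \<i> * of_real x) k / (pochhammer (a + c) k * pochhammer (a + d) k)"
      by (simp add: mult_ac)
  qed
  finally show ?thesis
    by (simp only: cont_hahn_def)
qed

theorem theorem2p3:
  fixes a :: real and b d b' d' r :: complex and x y :: real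
  assumes "a > 0"
    and "Re b > 0" "Re d > 0" "Re b' > 0" "Re d' > 0"
    and "b + d = b' + d'" "cnj d = b" "cnj d' = b'"
    and "norm r < 1"
  shows "(\<lambda>j. ((-1) ^ j * fact j /
              (pochhammer (2 * of_real a) j * pochhammer (b + d) j *
               pochhammer (2 * of_real a + b + d + of_nat j - 1) j) *
              hypergeom [of_real a + d + of_nat j, of_real a + d' + of_nat j]
                        [2 * of_real a + b + d + 2 * of_nat j] r)
            * cont_hahn j x (of_real a) b (of_real a) d
            * cont_hahn j y (of_real a) b' (of_real a) d' * r ^ j)
         sums (hypergeom [of_real a + \<i> * of_real x, of_real a + \<i> * of_real y] [2 * of_real a] r *
               hypergeom [d - \<i> * of_real x, d' - \<i> * of_real y] [b + d] r)"
proof -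
  \<comment> \<open>Since b is the conjugate of d, the sum b + d equals 2 Re d. It is therefore a
    positive real, as the positivity argument requires, and b' + d' has the same value.\<close>
  define \<alpha> \<beta> where "\<alpha> = 2 * a" and "\<beta> = 2 * Re d"
  define s t where "s = of_real a + d" and "t = of_real a + d'"
  define A B where "A = of_real a + \<i> * complex_of_real x" and "B = of_real a + \<i> * complex_of_real y"
  let ?\<alpha> = "complex_of_real \<alpha>" and ?\<beta> = "complex_of_real \<beta>"
  have pos: "\<alpha> > 0" "\<beta> > 0"
    using assms by (simp_all add: \<alpha>_def \<beta>_def)
  have s: "s \<notin> \<int>\<^sub>\<le>\<^sub>0" and t: "t \<notin> \<int>\<^sub>\<le>\<^sub>0" and \<alpha>: "?\<alpha> \<notin> \<int>\<^sub>\<le>\<^sub>0"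
    using assms pos by (auto intro!: positive_notin_nonpos_Ints simp: s_def t_def)
  have bd: "b + d = ?\<beta>" "b' + d' = ?\<beta>"
    using assms by (auto simp: \<beta>_def complex_eq_iff)
  have params: "2 * of_real a = ?\<alpha>" "of_real a + of_real a = ?\<alpha>"
    "?\<alpha> + b + d = ?\<alpha> + ?\<beta>" "of_real a + b + of_real a + d = ?\<alpha> + ?\<beta>"
    "of_real a + b' + of_real a + d' = ?\<alpha> + ?\<beta>"
    using bd by (simp_all add: \<alpha>_def algebra_simps)
  have diffs: "d - \<i> * of_real x = s - A" "d' - \<i> * of_real y = t - B"
    by (simp_all add: s_def t_def A_def B_def)
  let ?F = "\<lambda>s. hahn_3F2 ?\<alpha> s (?\<alpha> + ?\<beta> - 1)"
  \<comment> \<open>The 2F1 inside h_j is expanded in powers r^k, and (s)_j (s + j)_k = (s)_(j+k)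
    merges the symbols, likewise for t. The sign (-1)^j cancels the two factors \<i>^j, and the
    (\<alpha>)_j in the denominator of h_j cancels one of the two from the polynomials.\<close>
  have terms: "(-1) ^ j * fact j / (pochhammer ?\<alpha> j * pochhammer ?\<beta> j * pochhammer (?\<alpha> + ?\<beta> + of_nat j - 1) j) *
        hypergeom [s + of_nat j, t + of_nat j] [?\<alpha> + ?\<beta> + 2 * of_nat j] r *
        (\<i> ^ j * pochhammer ?\<alpha> j * pochhammer s j / fact j * ?F s j A) *
        (\<i> ^ j * pochhammer ?\<alpha> j * pochhammer t j / fact j * ?F t j B) * r ^ j =
      (\<Sum>k. of_real (hahn_coeff \<alpha> \<beta> j k) * (pochhammer s (j + k) * ?F s j A) * (pochhammer t (j + k) * ?F t j B) * r ^ (j + k))"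
    for j
  proof -
    have "Re (?\<alpha> + ?\<beta> + 2 * of_nat j) > 0"
      using pos by simp
    then have summ: "summable (\<lambda>k. pochhammer (s + of_nat j) k * pochhammer (t + of_nat j) k /
        (pochhammer (?\<alpha> + ?\<beta> + 2 * of_nat j) k * fact k) * r ^ k)"
      using assms(9) by (intro summable_norm_cancel[OF summable_norm_2F1] positive_notin_nonpos_Ints)
    define C where "C = pochhammer ?\<alpha> j * pochhammer s j * pochhammer t j * ?F s j A * ?F t j B * r ^ j /
      (fact j * pochhammer ?\<beta> j * pochhammer (?\<alpha> + ?\<beta> - 1 + of_nat j) j)"
    have sign: "(-1) ^ j * (\<i> ^ j * \<i> ^ j) = (1 :: complex)"
      by (simp flip: power_mult_distrib)
    have shift: "?\<alpha> + ?\<beta> + of_nat j - 1 = ?\<alpha> + ?\<beta> - 1 + of_nat j"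
      by simp
    have arrange: "e * F / (P * Q * R) * H * (i * P * S / F * X) * (i * P * T / F * Y) * z =
        e * (i * i) * (P * S * T * X * Y * z / (F * Q * R)) * H" if "F \<noteq> 0" "P \<noteq> 0"
      for e F P Q R H i S X T Y z :: complex
      using that by (simp add: field_simps)
    have "pochhammer ?\<alpha> j \<noteq> 0"
      using pochhammer_nonzero[OF \<alpha>, of 0 j] by simp
    then have "(-1) ^ j * fact j / (pochhammer ?\<alpha> j * pochhammer ?\<beta> j * pochhammer (?\<alpha> + ?\<beta> + of_nat j - 1) j) *
        hypergeom [s + of_nat j, t + of_nat j] [?\<alpha> + ?\<beta> + 2 * of_nat j] r *
        (\<i> ^ j * pochhammer ?\<alpha> j * pochhammer s j / fact j * ?F s j A) *
        (\<i> ^ j * pochhammer ?\<alpha> j * pochhammer t j / fact j * ?F t j B) * r ^ j =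
      C * hypergeom [s + of_nat j, t + of_nat j] [?\<alpha> + ?\<beta> + 2 * of_nat j] r"
      by (subst arrange) (simp_all only: fact_nonzero not_False_eq_True sign shift C_def mult_1_left)
    also have "\<dots> = (\<Sum>k. C * (pochhammer (s + of_nat j) k * pochhammer (t + of_nat j) k /
        (pochhammer (?\<alpha> + ?\<beta> + 2 * of_nat j) k * fact k) * r ^ k))"
      unfolding hypergeom_2F1 by (rule suminf_mult[OF summ, symmetric])
    also have "\<dots> = (\<Sum>k. of_real (hahn_coeff \<alpha> \<beta> j k) * (pochhammer s (j + k) * ?F s j A) *
        (pochhammer t (j + k) * ?F t j B) * r ^ (j + k))"
      unfolding hahn_coeff_of_real[symmetric]
      by (simp add: C_def hahn_coeff_def pochhammer_product' power_add mult_ac)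
    finally show ?thesis .
  qed
  show ?thesis
    unfolding cont_hahn_eq_hahn_3F2 params bd diffs
    unfolding s_def[symmetric] t_def[symmetric] A_def[symmetric] B_def[symmetric] terms
    by (rule hahn_3F2_sums[OF pos s t assms(9)])
qed

end
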